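(* (i) Let $P>0$ be an integer with $P^2-4\neq 0$, and let $n$ be a Lucas pseudoprime with parameters $P$ and $Q=1$. Let $\widetilde{x}, \widetilde{y}$ be integers with $\widetilde{x} \equiv 2^{-1}P \pmod n$ and $\widetilde{y} \equiv 2^{-1} \pmod n$. Then $n$ is a Pell pseudoprime with parameters $D = P^2-4$ and $(\widetilde{x}, \widetilde{y})$. (ii) Conversely, let $D$ be an integer and let $n$ be a Pell pseudoprime with parameters $D$ and $(\widetilde{x}, \widetilde{y})$, where $\widetilde{x},\widetilde{y}$ are integers. Then $n$ is a Lucas pseudoprime with parameters $P = 2\widetilde{x}$ and $Q = 1$.
   Context: For integers $P, Q$, the Lucas sequence $(U_k(P,Q))_{k\ge0}$ is defined by $U_0 = 0$, $U_1 = 1$, $U_k = PU_{k-1} - QU_{k-2}$ for $k\ge 2$. For an odd integer $n$, $\big(\tfrac{D}{n}\big)$ denotes the Jacobi symbol. An odd composite integer $n$ with $\gcd(n,Q)=1$ is a Lucas pseudoprime with parameters $P, Q$ if $U_{n - (D/n)}(P,Q) \equiv 0 \pmod n$, where $D = P^2 - 4Q$ (the paper's standing convention for Lucas sequences is $P>0$ and $P^2-4Q\neq 0$). For an integer $D$ and pairs of integers, the Brahmagupta product is $(x_1,y_1)\otimes_D (x_2,y_2) := (x_1x_2 + Dy_1y_2,\ x_1y_2 + x_2y_1)$, with powers $(x,y)^{\otimes 0} = (1,0)$, $(x,y)^{\otimes(k+1)} = (x,y)^{\otimes k}\otimes_D(x,y)$. The Pell conic over $\mathbb{Z}_n=\mathbb{Z}/n\mathbb{Z}$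 is $\mathcal{C}_D(\mathbb{Z}_n) = \{(x,y)\in\mathbb{Z}_n^2 : x^2 - Dy^2 = 1\}$. An odd composite integer $n$ is a Pell pseudoprime with parameters $D$ and $(\widetilde{x},\widetilde{y})$ if $(\widetilde{x}\bmod n, \widetilde{y}\bmod n)\in \mathcal{C}_D(\mathbb{Z}_n)$ (i.e. $\widetilde{x}^2 - D\widetilde{y}^2\equiv 1 \pmod n$), $\gcd(n,\widetilde{y}) = 1$, and $y_n \equiv 0 \pmod n$, where $(x_n, y_n) = (\widetilde{x},\widetilde{y})^{\otimes (n - (D/n))}$ computed with $\otimes_D$. *)

theory Defs
  imports "HOL-Number_Theory.Number_Theory"
begin

fun lucas_U :: "int \<Rightarrow> int \<Rightarrow> nat \<Rightarrow> int" where
  "lucas_U P Q 0 = 0"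
| "lucas_U P Q (Suc 0) = 1"
| "lucas_U P Q (Suc (Suc k)) = P * lucas_U P Q (Suc k) - Q * lucas_U P Q k"

text \<open>
  The factorization is a multiset of positive primes, so that each prime contributes according
  to its multiplicity; the definition is meant for odd \<open>n > 0\<close>.
\<close>
definition Jacobi :: "int \<Rightarrow> int \<Rightarrow> int" where
  "Jacobi a n = (\<Prod>p\<in>#prime_factorization n. Legendre a p)"

definition composite :: "int \<Rightarrow> bool" where
  "composite n \<longleftrightarrow> 1 < n \<and> \<not> prime n"

text \<open>
  The general conventions \<open>P > 0\<close> and \<open>P\<^sup>2 - 4 * Q \<noteq> 0\<close> for Lucas sequences are not built into the
  predicate. For odd composite \<open>n\<close> the index \<open>n - Jacobi D n\<close> is positive, so \<open>nat\<close> does not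
  truncate here or in the Pell case below.
\<close>
definition lucas_pseudoprime :: "int \<Rightarrow> int \<Rightarrow> int \<Rightarrow> bool" where
  "lucas_pseudoprime P Q n \<longleftrightarrow>
     odd n \<and> composite n \<and> gcd n Q = 1 \<and>
     [lucas_U P Q (nat (n - Jacobi (P\<^sup>2 - 4 * Q) n)) = 0] (mod n)"

fun brahmagupta :: "int \<Rightarrow> int \<times> int \<Rightarrow> int \<times> int \<Rightarrow> int \<times> int" where
  "brahmagupta D (x1, y1) (x2, y2) = (x1 * x2 + D * y1 * y2, x1 * y2 + x2 * y1)"

primrec brahmagupta_power :: "int \<Rightarrow> int \<times> int \<Rightarrow> nat \<Rightarrow> int \<times> int" where
  "brahmagupta_power D z 0 = (1, 0)"
| "brahmagupta_power D z (Suc k) = brahmagupta D (brahmagupta_power D z k) z"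

text \<open>Residue classes modulo \<open>n\<close> are represented by the integers in \<open>{0..<n}\<close>.\<close>
definition pell_conic :: "int \<Rightarrow> int \<Rightarrow> (int \<times> int) set" where
  "pell_conic D n = {(x, y). x \<in> {0..<n} \<and> y \<in> {0..<n} \<and> [x\<^sup>2 - D * y\<^sup>2 = 1] (mod n)}"

definition pell_pseudoprime :: "int \<Rightarrow> int \<times> int \<Rightarrow> int \<Rightarrow> bool" where
  "pell_pseudoprime D z n \<longleftrightarrow>
     odd n \<and> composite n \<and>
     (fst z mod n, snd z mod n) \<in> pell_conic D n \<and> gcd n (snd z) = 1 \<and>
     [snd (brahmagupta_power D z (nat (n - Jacobi D n))) = 0] (mod n)"

end

theory Submission
  imports Defs
begin

text \<open>
  The Pell powers satisfy \<open>y\<^sub>k = y * U\<^sub>k(2x, x\<^sup>2 - D y\<^sup>2)\<close> exactly over the integers. Modulo \<open>n\<close> the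
  second parameter is \<open>1\<close> on the Pell conic and \<open>y\<close> is a unit, so \<open>y\<^sub>k\<close> vanishes iff
  \<open>U\<^sub>k(2x, 1)\<close> does. The index \<open>k = n - (D/n)\<close> is the same on both sides because
  \<open>(2x)\<^sup>2 - 4 \<equiv> (2y)\<^sup>2 D\<close>, which differs from \<open>D\<close> by the square of a unit.
\<close>

text \<open>The pair \<open>(x, y)\<close> stands for x + y sqrt(D), a root of t^2 - 2xt + (x^2 - D
  y^2). Hence the coordinates of its powers obey the Lucas recurrence with the trace and the norm as
  parameters.\<close>

lemma snd_brahmagupta_power:
  "snd (brahmagupta_power D (x, y) k) = y * lucas_U (2 * x) (x\<^sup>2 - D * y\<^sup>2) k"
proof (induction "2 * x" "x\<^sup>2 - D * y\<^sup>2" k rule: lucas_U.induct)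
  case (3 k)
  obtain a b where ab: "brahmagupta_power D (x, y) k = (a, b)"
    by fastforce
  have "snd (brahmagupta_power D (x, y) (Suc (Suc k))) =
      2 * x * (a * y + x * b) - (x\<^sup>2 - D * y\<^sup>2) * b"
    by (simp add: ab algebra_simps power2_eq_square)
  \<comment> \<open>\<open>a * y + x * b\<close> is the second coordinate of the power
    \<open>Suc k\<close>.\<close>
  also have "a * y + x * b = y * lucas_U (2 * x) (x\<^sup>2 - D * y\<^sup>2) (Suc k)"
    using 3(1) ab by (simp add: mult.commute)
  also have "b = y * lucas_U (2 * x) (x\<^sup>2 - D * y\<^sup>2) k"
    using 3(2) ab by simp
  finally show ?case
    by (simp add: right_diff_distrib mult.left_commute)
qed simp_all

lemma lucas_U_cong:
  assumes "[P = P'] (mod n)" "[Q = Q'] (mod n)"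
  shows "[lucas_U P Q k = lucas_U P' Q' k] (mod n)"
  using assms
  by (induction P Q k rule: lucas_U.induct) (auto intro!: cong_diff cong_mult)

text \<open>As \<open>c\<close> is a unit, the relation between \<open>a\<close> and
  \<open>b\<close> is symmetric: multiplying by the square of an inverse \<open>d\<close> of
  \<open>c\<close> gives b \<equiv> d^2 a. So each case of the Legendre symbol has to be transferred
  in one direction only.\<close>

lemma Legendre_cong_square_mult:
  assumes "[a = c\<^sup>2 * b] (mod p)" "coprime c p"
  shows "Legendre a p = Legendre b p"
proof -
  obtain d where d: "[c * d = 1] (mod p)"
    using cong_solve_coprime_int[OF assms(2)] by auto
  have "[d\<^sup>2 * a = d\<^sup>2 * (c\<^sup>2 * b)] (mod p)"
    using assms(1) by (rule cong_scalar_left)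
  also have "d\<^sup>2 * (c\<^sup>2 * b) = (c * d)\<^sup>2 * b"
    by (simp add: power_mult_distrib)
  also have "[\<dots> = 1\<^sup>2 * b] (mod p)"
    by (intro cong_mult cong_pow d cong_refl)
  finally have b: "[b = d\<^sup>2 * a] (mod p)"
    by (simp add: cong_sym)
  \<comment> \<open>Used twice: with \<open>e = c\<close> to pass from \<open>b\<close> to
    \<open>a\<close>, and with \<open>e = d\<close> to pass back.\<close>
  have "[u = 0] (mod p) \<Longrightarrow> [v = 0] (mod p)" and "QuadRes p u \<Longrightarrow> QuadRes p v"
    if uv: "[v = e\<^sup>2 * u] (mod p)" for u v e
  proof -
    show "[v = 0] (mod p)" if "[u = 0] (mod p)"
      using cong_trans[OF uv cong_scalar_left[OF that, of "e\<^sup>2"]] by simp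
    show "QuadRes p v" if u: "QuadRes p u"
    proof -
      obtain t where "[t\<^sup>2 = u] (mod p)"
        using u by (auto simp: QuadRes_def)
      then have "[(e * t)\<^sup>2 = e\<^sup>2 * u] (mod p)"
        by (simp add: power_mult_distrib cong_scalar_left)
      then show ?thesis
        unfolding QuadRes_def using cong_trans[OF _ cong_sym[OF uv]] by blast
    qed
  qed
  from this[OF assms(1)] this[OF b] show ?thesis
    by (auto simp: Legendre_def)
qed

text \<open>The congruence and the coprimality descend from \<open>n\<close> to each prime factor,
  so the two products agree factor by factor.\<close>

lemma Jacobi_cong_square_mult:
  assumes "[a = c\<^sup>2 * b] (mod n)" "coprime c n"
  shows "Jacobi a n = Jacobi b n"
proof -
  have "Legendre a p = Legendre b p" if "p \<in># prime_factorization n" for p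
  proof -
    have "p dvd n"
      using that by (rule in_prime_factors_imp_dvd)
    with assms show ?thesis
      by (intro Legendre_cong_square_mult)
        (auto intro: cong_dvd_modulus coprime_divisors[of c c p n])
  qed
  then show ?thesis
    unfolding Jacobi_def by (auto intro!: arg_cong[of _ _ prod_mset] image_mset_cong)
qed

lemma mod_in_pell_conic_iff:
  assumes "n > 0"
  shows "(x mod n, y mod n) \<in> pell_conic D n \<longleftrightarrow> [x\<^sup>2 - D * y\<^sup>2 = 1] (mod n)"
proof -
  have "[(x mod n)\<^sup>2 - D * (y mod n)\<^sup>2 = x\<^sup>2 - D * y\<^sup>2] (mod n)"
    by (intro cong_diff cong_mult cong_pow cong_refl) simp_all
  with assms show ?thesis
    by (auto simp: pell_conic_def intro: cong_trans cong_sym)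
qed

text \<open>Serves both directions. \<open>P\<close> is fixed only modulo \<open>n\<close> because
  in the first direction \<open>x\<close> is just a residue of P/2; in the second, \<open>P\<close>
  is \<open>2 * x\<close> itself.\<close>

lemma snd_brahmagupta_power_cong_0_iff:
  assumes "[x\<^sup>2 - D * y\<^sup>2 = 1] (mod n)" "coprime y n" "[P = 2 * x] (mod n)"
  shows "[snd (brahmagupta_power D (x, y) k) = 0] (mod n) \<longleftrightarrow> [lucas_U P 1 k = 0] (mod n)"
proof -
  have "[lucas_U P 1 k = lucas_U (2 * x) (x\<^sup>2 - D * y\<^sup>2) k] (mod n)"
    using assms by (intro lucas_U_cong) (auto intro: cong_sym)
  moreover have "[y * u = 0] (mod n) \<longleftrightarrow> [u = 0] (mod n)" for u
    using assms(2) by (simp add: cong_0_iff coprime_commute coprime_dvd_mult_right_iff)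
  ultimately show ?thesis
    by (auto simp: snd_brahmagupta_power intro: cong_trans cong_sym)
qed

text \<open>Here \<open>D\<close> is the Lucas discriminant itself, so the two indices coincide
  without comparing Jacobi symbols. The integer \<open>i\<close> plays the role of 1/2.\<close>

lemma lucas_pseudoprime_imp_pell_pseudoprime:
  assumes "lucas_pseudoprime P 1 n" "[x = i * P] (mod n)" "[y = i] (mod n)" "[2 * i = 1] (mod n)"
  shows "pell_pseudoprime (P\<^sup>2 - 4) (x, y) n"
proof -
  have n: "odd n" "composite n" "n > 0"
    using assms(1) by (auto simp: lucas_pseudoprime_def composite_def)
  have "[2 * y = 2 * i] (mod n)"
    using assms(3) by (rule cong_scalar_left)
  \<comment> \<open>\<open>2\<close> is an inverse of \<open>y\<close>, which makes \<open>y\<close>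
    a unit.\<close>
  then have "[y * 2 = 1] (mod n)"
    using assms(4) by (auto simp: mult.commute intro: cong_trans)
  then have y: "coprime y n"
    using coprime_iff_invertible_int by blast
  have "[x\<^sup>2 - (P\<^sup>2 - 4) * y\<^sup>2 = (i * P)\<^sup>2 - (P\<^sup>2 - 4) * i\<^sup>2] (mod n)"
    by (intro cong_diff cong_mult cong_pow cong_refl assms)
  also have "(i * P)\<^sup>2 - (P\<^sup>2 - 4) * i\<^sup>2 = (2 * i)\<^sup>2"
    by (simp add: algebra_simps power2_eq_square)
  also have "[\<dots> = 1\<^sup>2] (mod n)"
    by (intro cong_pow assms)
  finally have conic: "[x\<^sup>2 - (P\<^sup>2 - 4) * y\<^sup>2 = 1] (mod n)"
    by simp
  have "[2 * x = 2 * (i * P)] (mod n)"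
    using assms(2) by (rule cong_scalar_left)
  also have "2 * (i * P) = 2 * i * P"
    by simp
  also have "[\<dots> = 1 * P] (mod n)"
    using assms(4) by (rule cong_scalar_right)
  finally have P: "[P = 2 * x] (mod n)"
    by (simp add: cong_sym)
  show ?thesis
    using n assms(1) y conic snd_brahmagupta_power_cong_0_iff[OF conic y P]
    by (simp add: pell_pseudoprime_def lucas_pseudoprime_def mod_in_pell_conic_iff
        coprime_iff_gcd_eq_1 gcd.commute)
qed

text \<open>Now \<open>D\<close> is arbitrary, so the symbols of \<open>D\<close> and of the Lucas
  discriminant 4x^2 - 4 must be shown equal.\<close>

lemma pell_pseudoprime_imp_lucas_pseudoprime:
  assumes "pell_pseudoprime D (x, y) n"
  shows "lucas_pseudoprime (2 * x) 1 n"
proof -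
  have n: "odd n" "composite n" "n > 0" and y: "coprime y n"
    using assms by (auto simp: pell_pseudoprime_def composite_def coprime_iff_gcd_eq_1 gcd.commute)
  have conic: "[x\<^sup>2 - D * y\<^sup>2 = 1] (mod n)"
    using assms n by (simp add: pell_pseudoprime_def mod_in_pell_conic_iff)
  \<comment> \<open>Four times the conic equation relates the discriminant (2x)^2 - 4 to (2y)^2
    D.\<close>
  then have "n dvd 4 * (x\<^sup>2 - D * y\<^sup>2 - 1)"
    by (intro dvd_mult) (simp only: cong_iff_dvd_diff)
  also have "4 * (x\<^sup>2 - D * y\<^sup>2 - 1) = (2 * x)\<^sup>2 - 4 * 1 - (2 * y)\<^sup>2 * D"
    by (simp add: power_mult_distrib algebra_simps)
  finally have "[(2 * x)\<^sup>2 - 4 * 1 = (2 * y)\<^sup>2 * D] (mod n)"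
    by (simp add: cong_iff_dvd_diff)
  moreover have "coprime (2 * y) n"
    using n y by simp
  ultimately have "Jacobi ((2 * x)\<^sup>2 - 4 * 1) n = Jacobi D n"
    by (rule Jacobi_cong_square_mult)
  then show ?thesis
    using n assms snd_brahmagupta_power_cong_0_iff[OF conic y cong_refl]
    by (simp add: pell_pseudoprime_def lucas_pseudoprime_def)
qed

theorem theorem1:
  shows "(\<forall>P n x y :: int.
            0 < P \<longrightarrow> P\<^sup>2 - 4 \<noteq> 0 \<longrightarrow> lucas_pseudoprime P 1 n \<longrightarrow>
            [x = modular_inverse n 2 * P] (mod n) \<longrightarrow>
            [y = modular_inverse n 2] (mod n) \<longrightarrow>
            pell_pseudoprime (P\<^sup>2 - 4) (x, y) n)
       \<and> (\<forall>D n x y :: int.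
            pell_pseudoprime D (x, y) n \<longrightarrow> lucas_pseudoprime (2 * x) 1 n)"
proof -
  \<comment> \<open>Since \<open>n\<close> is odd, 2 is a unit and
    \<open>modular_inverse n 2\<close> is a genuine inverse.\<close>
  have "[2 * modular_inverse n 2 = 1] (mod n)" if "lucas_pseudoprime P 1 n" for P n :: int
    using that by (intro cong_modular_inverse1) (simp add: lucas_pseudoprime_def)
  then show ?thesis
    using lucas_pseudoprime_imp_pell_pseudoprime pell_pseudoprime_imp_lucas_pseudoprime by blast
qed

end
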